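(* Let $(X_k)_{k\in\mathbb N}$ be a sequence of independent centered real random variables such that $|X_k|\le c_0$ for all $k$, for some $c_0>0$, and $\mathrm{Var}[X_k]=\mathbb E[X_k^2]\ge c_1$ for all $k$, for some $c_1>0$. Put $M_n=\frac1n\sum_{k=1}^nX_k$ and $B_n=\sum_{k=1}^n\mathbb E[X_k^2]$. Then, for $c>0$ and $\alpha\in(0,\tfrac12)$, we have, as $n\to\infty$, $$\mathbb P\big[M_n>c\,n^{\alpha-1}B_n^{1/2}\big]=\exp\Big(-\tfrac12c^2n^{2\alpha}\big(1+\mathrm o(1)\big)\Big).$$ Moreover, the bounds $$\mathbb P\big[M_n>c\,c_0\,n^{\alpha-1/2}\big]\le\exp\Big(-\tfrac12c^2n^{2\alpha}\big(1+\mathrm o(1)\big)\Big)\le\mathbb P\big[M_n>c\,c_1^{1/2}\,n^{\alpha-1/2}\big]$$ hold as $n\to\infty$.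
   Context: A random variable is centered if its expectation is $0$. The symbol $\mathrm o(1)$ denotes a quantity tending to $0$ as $n\to\infty$, with $c$, $\alpha$ and the sequence $(X_k)$ fixed. *)

theory Defs
  imports "HOL-Probability.Probability"
begin

definition empirical_mean :: "(nat \<Rightarrow> 'a \<Rightarrow> real) \<Rightarrow> nat \<Rightarrow> 'a \<Rightarrow> real" where
  "empirical_mean X n \<omega> = (1 / real n) * (\<Sum>k=1..n. X k \<omega>)"

definition second_moment_sum :: "'a measure \<Rightarrow> (nat \<Rightarrow> 'a \<Rightarrow> real) \<Rightarrow> nat \<Rightarrow> real" where
  "second_moment_sum M X n = (\<Sum>k=1..n. prob_space.expectation M (\<lambda>\<omega>. (X k \<omega>)\<^sup>2))"

end

theory Submission imports Defs begin

text \<open>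
  After rescaling \<open>S\<^sub>n = \<Sum>k\<le>n. X\<^sub>k\<close> to \<open>Y\<^sub>n = S\<^sub>n / (n\<^sup>\<alpha> B\<^sub>n\<^sup>1\<^sup>/\<^sup>2)\<close>, the claim is a large deviation estimate
  for \<open>Y\<^sub>n\<close> at speed \<open>a\<^sub>n = n\<^sup>2\<^sup>\<alpha>\<close> with rate function \<open>c\<^sup>2/2\<close>. Second-order Taylor bounds for the
  exponential give \<open>ln E[exp (a\<^sub>n s Y\<^sub>n)] / a\<^sub>n \<longlonglongrightarrow> s\<^sup>2/2\<close> for every \<open>s > 0\<close>. The upper bound is then
  Chernoff's inequality; for the lower bound, the expectation at \<open>s = c + \<delta>\<close> is up to a factor
  \<open>1 + o(1)\<close> carried by the event \<open>c < Y\<^sub>n \<le> c + 2\<delta>\<close>. The second pair of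
  bounds follows from \<open>c\<^sub>1 n \<le> B\<^sub>n \<le> c\<^sub>0\<^sup>2 n\<close> and monotonicity, with the same error sequence.
\<close>

section \<open>Elementary inequalities for the exponential\<close>

lemma exp_taylor2_bounds:
  fixes x b :: real
  assumes "\<bar>x\<bar> \<le> b"
  shows "exp x \<le> 1 + x + x\<^sup>2 / 2 * exp b"
    and "1 + x + x\<^sup>2 / 2 * exp (- b) \<le> exp x"
proof -
  \<comment> \<open>Lagrange form of the second-order remainder: the intermediate point satisfies
    \<open>\<bar>t\<bar> \<le> \<bar>x\<bar> \<le> b\<close>, so \<open>exp t\<close> lies between
    \<open>exp (- b)\<close> and \<open>exp b\<close>.\<close>
  obtain t where t: "\<bar>t\<bar> \<le> \<bar>x\<bar>" "exp x = (\<Sum>m<2. x ^ m / fact m) + exp t / fact 2 * x ^ 2"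
    using Maclaurin_exp_le[of x 2] by auto
  have e: "exp x = 1 + x + x\<^sup>2 / 2 * exp t"
    using t(2) by (simp add: numeral_2_eq_2)
  have "exp t \<le> exp b" "exp (- b) \<le> exp t"
    using t(1) assms by auto
  then show "exp x \<le> 1 + x + x\<^sup>2 / 2 * exp b" "1 + x + x\<^sup>2 / 2 * exp (- b) \<le> exp x"
    unfolding e by (auto intro!: mult_left_mono)
qed

text \<open>This is \<open>1 + x \<le> exp x\<close> at \<open>x = - u / (1 + u)\<close>, followed
  by taking reciprocals. It puts a lower bound \<open>1 + u\<close> into exponential form, so that
  such bounds can be multiplied over independent summands.\<close>

lemma exp_le_one_plus:
  fixes u :: real
  assumes "0 \<le> u"
  shows "exp (u / (1 + u)) \<le> 1 + u"
proof -
  have "1 / (1 + u) = 1 + - (u / (1 + u))"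
    using assms by (simp add: field_simps)
  also have "\<dots> \<le> exp (- (u / (1 + u)))"
    by (rule exp_ge_add_one_self)
  finally show ?thesis
    using assms by (simp add: exp_minus field_simps)
qed

section \<open>Moment generating functions of bounded centered variables and of their sums\<close>

context prob_space
begin

lemma integrable_exp_bounded:
  fixes X :: "'a \<Rightarrow> real"
  assumes [measurable]: "random_variable borel X" and "AE \<omega> in M. \<bar>X \<omega>\<bar> \<le> b"
  shows "integrable M (\<lambda>\<omega>. exp (l * X \<omega>))"
proof (rule integrable_const_bound[where B = "exp (\<bar>l\<bar> * b)"])
  show "AE \<omega> in M. norm (exp (l * X \<omega>)) \<le> exp (\<bar>l\<bar> * b)"
    using assms(2)
  proof eventually_elim
    case (elim \<omega>)
    have "l * X \<omega> \<le> \<bar>l\<bar> * \<bar>X \<omega>\<bar>"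
      by (metis abs_ge_self abs_mult)
    also have "\<dots> \<le> \<bar>l\<bar> * b"
      using elim by (intro mult_left_mono) auto
    finally show ?case by simp
  qed
qed measurable

text \<open>Integrating the Taylor bounds for \<open>exp (l * X)\<close> kills the linear term,
  because \<open>X\<close> is centered, and leaves \<open>1\<close> plus a multiple of
  \<open>v\<close>; both sides are then put into exponential form. The correction factors depend
  only on \<open>l\<close> and \<open>b\<close>, so they are common to all summands, and they tend
  to 1 as \<open>l\<close> tends to 0.\<close>

lemma bounded_centered_mgf_bounds:
  fixes X :: "'a \<Rightarrow> real"
  assumes [measurable]: "random_variable borel X" and bd: "AE \<omega> in M. \<bar>X \<omega>\<bar> \<le> b"
    and mean: "expectation X = 0" and "0 \<le> b" and "0 \<le> l"
  defines "v \<equiv> expectation (\<lambda>\<omega>. (X \<omega>)\<^sup>2)"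
  shows "expectation (\<lambda>\<omega>. exp (l * X \<omega>)) \<le> exp (l\<^sup>2 * v / 2 * exp (l * b))"
    and "exp (l\<^sup>2 * v / 2 * (exp (- (l * b)) / (1 + l\<^sup>2 * b\<^sup>2 / 2)))
           \<le> expectation (\<lambda>\<omega>. exp (l * X \<omega>))"
    and "v \<le> b\<^sup>2"
proof -
  have int_X: "integrable M X"
    using bd by (intro integrable_const_bound[where B = b]) auto
  have sq: "AE \<omega> in M. (X \<omega>)\<^sup>2 \<le> b\<^sup>2"
    using bd by eventually_elim (metis abs_ge_zero power2_abs power_mono)
  have int_sq: "integrable M (\<lambda>\<omega>. (X \<omega>)\<^sup>2)"
    using sq by (intro integrable_const_bound[where B = "b\<^sup>2"]) auto
  have int_exp: "integrable M (\<lambda>\<omega>. exp (l * X \<omega>))"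
    using bd by (intro integrable_exp_bounded) auto
  show vb: "v \<le> b\<^sup>2"
    unfolding v_def using sq int_sq by (intro integral_le_const) auto
  have v0: "0 \<le> v"
    unfolding v_def by simp
  have quad: "expectation (\<lambda>\<omega>. 1 + l * X \<omega> + (X \<omega>)\<^sup>2 * k) = 1 + v * k" for k
    using int_X int_sq by (simp add: mean v_def prob_space)
  have int_quad: "integrable M (\<lambda>\<omega>. 1 + l * X \<omega> + (X \<omega>)\<^sup>2 * k)" for k
    using int_X int_sq by simp
  have bd': "AE \<omega> in M. \<bar>l * X \<omega>\<bar> \<le> l * b"
    using bd by eventually_elim (use \<open>0 \<le> l\<close> in \<open>simp add: abs_mult mult_left_mono\<close>)
  have "expectation (\<lambda>\<omega>. exp (l * X \<omega>))
      \<le> expectation (\<lambda>\<omega>. 1 + l * X \<omega> + (X \<omega>)\<^sup>2 * (l\<^sup>2 / 2 * exp (l * b)))"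
    using bd' by (intro integral_mono_AE int_exp int_quad, eventually_elim)
      (drule exp_taylor2_bounds(1), simp add: power_mult_distrib mult_ac)
  also have "\<dots> \<le> exp (l\<^sup>2 * v / 2 * exp (l * b))"
    unfolding quad using exp_ge_add_one_self[of "l\<^sup>2 * v / 2 * exp (l * b)"] by (simp add: mult_ac)
  finally show "expectation (\<lambda>\<omega>. exp (l * X \<omega>)) \<le> exp (l\<^sup>2 * v / 2 * exp (l * b))" .
  define u where "u = l\<^sup>2 * v / 2 * exp (- (l * b))"
  have u0: "0 \<le> u"
    unfolding u_def using v0 by simp
  \<comment> \<open>The exponent \<open>u / (1 + u)\<close> is not linear in \<open>v\<close>.
    Replacing the denominator by a bound free of \<open>v\<close> restores linearity, so that
    variances add up when the estimates are multiplied.\<close>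
  have "u \<le> l\<^sup>2 * b\<^sup>2 / 2 * 1"
    unfolding u_def using vb v0 \<open>0 \<le> l\<close> \<open>0 \<le> b\<close>
    by (intro mult_mono divide_right_mono mult_left_mono) auto
  then have "u / (1 + l\<^sup>2 * b\<^sup>2 / 2) \<le> u / (1 + u)"
    using u0 by (intro divide_left_mono mult_pos_pos add_pos_nonneg) auto
  then have "exp (u / (1 + l\<^sup>2 * b\<^sup>2 / 2)) \<le> 1 + u"
    using exp_le_one_plus[OF u0] by (meson exp_le_cancel_iff order_trans)
  also have "1 + u = expectation (\<lambda>\<omega>. 1 + l * X \<omega> + (X \<omega>)\<^sup>2 * (l\<^sup>2 / 2 * exp (- (l * b))))"
    unfolding quad u_def by (simp add: mult_ac)
  also have "\<dots> \<le> expectation (\<lambda>\<omega>. exp (l * X \<omega>))"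
    using bd' by (intro integral_mono_AE int_exp int_quad, eventually_elim)
      (drule exp_taylor2_bounds(2), simp add: power_mult_distrib mult_ac)
  finally show "exp (l\<^sup>2 * v / 2 * (exp (- (l * b)) / (1 + l\<^sup>2 * b\<^sup>2 / 2)))
      \<le> expectation (\<lambda>\<omega>. exp (l * X \<omega>))"
    unfolding u_def by simp
qed

lemma indep_sum_mgf:
  fixes X :: "'i \<Rightarrow> 'a \<Rightarrow> real"
  assumes "finite I" and ind: "indep_vars (\<lambda>_. borel) X I"
    and int: "\<And>i. i \<in> I \<Longrightarrow> integrable M (\<lambda>\<omega>. exp (l * X i \<omega>))"
  shows "expectation (\<lambda>\<omega>. exp (l * (\<Sum>i\<in>I. X i \<omega>)))
           = (\<Prod>i\<in>I. expectation (\<lambda>\<omega>. exp (l * X i \<omega>)))"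
    and "integrable M (\<lambda>\<omega>. exp (l * (\<Sum>i\<in>I. X i \<omega>)))"
proof -
  have e: "exp (l * (\<Sum>i\<in>I. X i \<omega>)) = (\<Prod>i\<in>I. exp (l * X i \<omega>))" for \<omega>
    using \<open>finite I\<close> by (simp add: sum_distrib_left exp_sum)
  have "indep_vars (\<lambda>_. borel) (\<lambda>i \<omega>. exp (l * X i \<omega>)) I"
    using ind by (rule indep_vars_compose2) measurable
  then show "expectation (\<lambda>\<omega>. exp (l * (\<Sum>i\<in>I. X i \<omega>)))
           = (\<Prod>i\<in>I. expectation (\<lambda>\<omega>. exp (l * X i \<omega>)))"
    and "integrable M (\<lambda>\<omega>. exp (l * (\<Sum>i\<in>I. X i \<omega>)))"
    unfolding e using \<open>finite I\<close> int
    by (auto intro!: indep_vars_lebesgue_integral indep_vars_integrable)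
qed

text \<open>By independence the expectation factorizes. Each factor is bounded by an exponential
  whose exponent is linear in its second moment with a common coefficient, so the product only
  replaces the second moment by the sum \<open>V\<close>.\<close>

lemma bounded_centered_sum_mgf_bounds:
  fixes X :: "'i \<Rightarrow> 'a \<Rightarrow> real"
  assumes "finite I" and ind: "indep_vars (\<lambda>_. borel) X I"
    and bd: "\<And>i. i \<in> I \<Longrightarrow> AE \<omega> in M. \<bar>X i \<omega>\<bar> \<le> b"
    and mean: "\<And>i. i \<in> I \<Longrightarrow> expectation (X i) = 0" and "0 \<le> b" and "0 \<le> l"
  defines "V \<equiv> \<Sum>i\<in>I. expectation (\<lambda>\<omega>. (X i \<omega>)\<^sup>2)"
  shows "integrable M (\<lambda>\<omega>. exp (l * (\<Sum>i\<in>I. X i \<omega>)))"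
    and "expectation (\<lambda>\<omega>. exp (l * (\<Sum>i\<in>I. X i \<omega>))) \<le> exp (l\<^sup>2 * V / 2 * exp (l * b))"
    and "exp (l\<^sup>2 * V / 2 * (exp (- (l * b)) / (1 + l\<^sup>2 * b\<^sup>2 / 2)))
           \<le> expectation (\<lambda>\<omega>. exp (l * (\<Sum>i\<in>I. X i \<omega>)))"
proof -
  have rv: "random_variable borel (X i)" if "i \<in> I" for i
    using ind that by (auto simp: indep_vars_def)
  have int: "integrable M (\<lambda>\<omega>. exp (l * X i \<omega>))" if "i \<in> I" for i
    using integrable_exp_bounded[OF rv bd] that by blast
  have mgf: "expectation (\<lambda>\<omega>. exp (l * (\<Sum>i\<in>I. X i \<omega>)))
           = (\<Prod>i\<in>I. expectation (\<lambda>\<omega>. exp (l * X i \<omega>)))"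
    "integrable M (\<lambda>\<omega>. exp (l * (\<Sum>i\<in>I. X i \<omega>)))"
    using indep_sum_mgf[OF \<open>finite I\<close> ind] int by blast+
  show "integrable M (\<lambda>\<omega>. exp (l * (\<Sum>i\<in>I. X i \<omega>)))"
    by (rule mgf(2))
  have prod_exp: "(\<Prod>i\<in>I. exp (l\<^sup>2 * expectation (\<lambda>\<omega>. (X i \<omega>)\<^sup>2) / 2 * k)) = exp (l\<^sup>2 * V / 2 * k)" for k
    using \<open>finite I\<close>
    by (simp add: V_def sum_distrib_left sum_distrib_right sum_divide_distrib flip: exp_sum)
  show "expectation (\<lambda>\<omega>. exp (l * (\<Sum>i\<in>I. X i \<omega>))) \<le> exp (l\<^sup>2 * V / 2 * exp (l * b))"
    unfolding mgf(1) prod_exp[symmetric]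
    using bounded_centered_mgf_bounds(1)[OF rv bd mean \<open>0 \<le> b\<close> \<open>0 \<le> l\<close>]
    by (intro prod_mono conjI) (auto intro!: integral_nonneg)
  show "exp (l\<^sup>2 * V / 2 * (exp (- (l * b)) / (1 + l\<^sup>2 * b\<^sup>2 / 2)))
           \<le> expectation (\<lambda>\<omega>. exp (l * (\<Sum>i\<in>I. X i \<omega>)))"
    unfolding mgf(1) prod_exp[symmetric]
    using bounded_centered_mgf_bounds(2)[OF rv bd mean \<open>0 \<le> b\<close> \<open>0 \<le> l\<close>]
    by (intro prod_mono conjI) auto
qed

section \<open>Exponential estimates for a family with quadratic limiting log-moment generating
  function\<close>

lemma exp_expectation_pos:
  fixes Z :: "'a \<Rightarrow> real"
  assumes "integrable M (\<lambda>\<omega>. exp (Z \<omega>))"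
  shows "0 < expectation (\<lambda>\<omega>. exp (Z \<omega>))"
  using expectation_greater[OF assms, of 0] by simp

text \<open>Undoes the logarithm in the limit: up to a slack \<epsilon> in the rate, the expectation
  behaves like that of a Gaussian. Integrability makes the expectation positive, so that
  \<open>exp\<close> and \<open>ln\<close> cancel.\<close>

lemma quadratic_rate_mgf_bounds:
  fixes Y :: "nat \<Rightarrow> 'a \<Rightarrow> real" and a :: "nat \<Rightarrow> real"
  assumes a: "filterlim a at_top sequentially"
    and int: "\<forall>\<^sub>F n in sequentially. integrable M (\<lambda>\<omega>. exp (a n * s * Y n \<omega>))"
    and lim: "(\<lambda>n. ln (expectation (\<lambda>\<omega>. exp (a n * s * Y n \<omega>))) / a n) \<longlonglongrightarrow> s\<^sup>2 / 2"
    and "0 < \<epsilon>"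
  shows "\<forall>\<^sub>F n in sequentially. expectation (\<lambda>\<omega>. exp (a n * s * Y n \<omega>)) \<le> exp (a n * (s\<^sup>2 / 2 + \<epsilon>))"
    and "\<forall>\<^sub>F n in sequentially. exp (a n * (s\<^sup>2 / 2 - \<epsilon>)) \<le> expectation (\<lambda>\<omega>. exp (a n * s * Y n \<omega>))"
proof -
  have pos: "\<forall>\<^sub>F n in sequentially. 0 < a n"
    using a by (simp add: filterlim_at_top_dense)
  have "\<forall>\<^sub>F n in sequentially. ln (expectation (\<lambda>\<omega>. exp (a n * s * Y n \<omega>))) / a n < s\<^sup>2 / 2 + \<epsilon>"
    using lim \<open>0 < \<epsilon>\<close> by (intro order_tendstoD) auto
  with pos int show "\<forall>\<^sub>F n in sequentially.
      expectation (\<lambda>\<omega>. exp (a n * s * Y n \<omega>)) \<le> exp (a n * (s\<^sup>2 / 2 + \<epsilon>))"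
  proof eventually_elim
    case (elim n)
    then have "ln (expectation (\<lambda>\<omega>. exp (a n * s * Y n \<omega>))) \<le> a n * (s\<^sup>2 / 2 + \<epsilon>)"
      by (simp add: pos_divide_less_eq mult_ac)
    then show ?case
      using exp_expectation_pos[OF elim(2)] by (metis exp_le_cancel_iff exp_ln)
  qed
  have "\<forall>\<^sub>F n in sequentially. s\<^sup>2 / 2 - \<epsilon> < ln (expectation (\<lambda>\<omega>. exp (a n * s * Y n \<omega>))) / a n"
    using lim \<open>0 < \<epsilon>\<close> by (intro order_tendstoD) auto
  with pos int show "\<forall>\<^sub>F n in sequentially.
      exp (a n * (s\<^sup>2 / 2 - \<epsilon>)) \<le> expectation (\<lambda>\<omega>. exp (a n * s * Y n \<omega>))"
  proof eventually_elim
    case (elim n)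
    then have "a n * (s\<^sup>2 / 2 - \<epsilon>) \<le> ln (expectation (\<lambda>\<omega>. exp (a n * s * Y n \<omega>)))"
      by (simp add: pos_less_divide_eq mult_ac)
    then show ?case
      using exp_expectation_pos[OF elim(2)] by (simp add: ln_ge_iff)
  qed
qed

lemma chernoff_upper_tail:
  fixes Y :: "'a \<Rightarrow> real"
  assumes [measurable]: "random_variable borel Y"
    and int: "integrable M (\<lambda>\<omega>. exp (l * Y \<omega>))" and "0 \<le> l"
  shows "prob {\<omega> \<in> space M. Y \<omega> > c} \<le> exp (- (l * c)) * expectation (\<lambda>\<omega>. exp (l * Y \<omega>))"
proof -
  have "prob {\<omega> \<in> space M. Y \<omega> > c} = expectation (indicator {\<omega> \<in> space M. Y \<omega> > c})"
    by simp
  also have "\<dots> \<le> expectation (\<lambda>\<omega>. exp (- (l * c)) * exp (l * Y \<omega>))"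
  proof (rule integral_mono)
    fix \<omega>
    show "indicator {\<omega> \<in> space M. Y \<omega> > c} \<omega> \<le> exp (- (l * c)) * exp (l * Y \<omega>)"
      using mult_left_mono[of c "Y \<omega>" l] \<open>0 \<le> l\<close>
      by (auto simp: indicator_def simp flip: exp_add)
  qed (use int in \<open>auto simp: emeasure_eq_measure\<close>)
  finally show ?thesis
    by simp
qed

text \<open>The parameter \<open>c + d\<close> is compared with \<open>c\<close> below \<open>c\<close> and with \<open>c + 2d\<close> above \<open>c + 2d\<close>.\<close>
lemma mgf_three_part_split:
  fixes Y :: "'a \<Rightarrow> real"
  assumes [measurable]: "random_variable borel Y"
    and int: "\<And>s. 0 < s \<Longrightarrow> integrable M (\<lambda>\<omega>. exp (a * s * Y \<omega>))"
    and "0 < c" "0 < d" "0 < a"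
  shows "expectation (\<lambda>\<omega>. exp (a * (c + d) * Y \<omega>))
    \<le> exp (a * d * c) * expectation (\<lambda>\<omega>. exp (a * c * Y \<omega>))
      + exp (a * (c + d) * (c + 2 * d)) * prob {\<omega> \<in> space M. Y \<omega> > c}
      + exp (- (a * d * (c + 2 * d))) * expectation (\<lambda>\<omega>. exp (a * (c + 2 * d) * Y \<omega>))"
proof -
  have int': "integrable M (\<lambda>\<omega>. exp (a * c * Y \<omega>))" "integrable M (\<lambda>\<omega>. exp (a * (c + d) * Y \<omega>))"
    "integrable M (\<lambda>\<omega>. exp (a * (c + 2 * d) * Y \<omega>))"
    using assms by (auto intro!: int)
  have "expectation (\<lambda>\<omega>. exp (a * (c + d) * Y \<omega>))
    \<le> expectation (\<lambda>\<omega>. exp (a * d * c) * exp (a * c * Y \<omega>)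
      + exp (a * (c + d) * (c + 2 * d)) * indicator {\<omega> \<in> space M. Y \<omega> > c} \<omega>
      + exp (- (a * d * (c + 2 * d))) * exp (a * (c + 2 * d) * Y \<omega>))"
  proof (rule integral_mono)
    fix \<omega> assume \<omega>: "\<omega> \<in> space M"
    consider "Y \<omega> \<le> c" | "c < Y \<omega>" "Y \<omega> \<le> c + 2 * d" | "c + 2 * d < Y \<omega>" by linarith
    then show "exp (a * (c + d) * Y \<omega>) \<le> exp (a * d * c) * exp (a * c * Y \<omega>)
      + exp (a * (c + d) * (c + 2 * d)) * indicator {\<omega> \<in> space M. Y \<omega> > c} \<omega>
      + exp (- (a * d * (c + 2 * d))) * exp (a * (c + 2 * d) * Y \<omega>)"
    proof cases
      case 1
      have "a * d * Y \<omega> \<le> a * d * c"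
        using 1 assms by (intro mult_left_mono) auto
      then have "exp (a * (c + d) * Y \<omega>) \<le> exp (a * d * c) * exp (a * c * Y \<omega>)"
        by (simp add: algebra_simps flip: exp_add)
      then show ?thesis
        by (smt (verit) exp_ge_zero indicator_pos_le mult_nonneg_nonneg)
    next
      case 2
      have "exp (a * (c + d) * Y \<omega>) \<le> exp (a * (c + d) * (c + 2 * d))"
        using 2 assms by simp
      then show ?thesis
        using 2 \<omega> by (simp add: indicator_def add_nonneg_nonneg add_increasing add_increasing2)
    next
      case 3
      have "a * d * (c + 2 * d) \<le> a * d * Y \<omega>"
        using 3 assms by (intro mult_left_mono) auto
      then have "exp (a * (c + d) * Y \<omega>) \<le> exp (- (a * d * (c + 2 * d))) * exp (a * (c + 2 * d) * Y \<omega>)"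
        by (simp add: algebra_simps flip: exp_add)
      then show ?thesis
        by (smt (verit) exp_ge_zero indicator_pos_le mult_nonneg_nonneg)
    qed
  qed (use int' in \<open>auto simp: emeasure_eq_measure\<close>)
  also have "\<dots> = exp (a * d * c) * expectation (\<lambda>\<omega>. exp (a * c * Y \<omega>))
      + exp (a * (c + d) * (c + 2 * d)) * prob {\<omega> \<in> space M. Y \<omega> > c}
      + exp (- (a * d * (c + 2 * d))) * expectation (\<lambda>\<omega>. exp (a * (c + 2 * d) * Y \<omega>))"
    using int' by (simp add: emeasure_eq_measure)
  finally show ?thesis .
qed

section \<open>The tail limit for a quadratic rate function\<close>

context
  fixes Y :: "nat \<Rightarrow> 'a \<Rightarrow> real" and a :: "nat \<Rightarrow> real" and c :: real
  assumes rv: "\<And>n. random_variable borel (Y n)"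
    and a_top: "filterlim a at_top sequentially"
    and int: "\<forall>\<^sub>F n in sequentially. \<forall>s>0. integrable M (\<lambda>\<omega>. exp (a n * s * Y n \<omega>))"
    and lim: "\<And>s. 0 < s \<Longrightarrow>
      (\<lambda>n. ln (expectation (\<lambda>\<omega>. exp (a n * s * Y n \<omega>))) / a n) \<longlonglongrightarrow> s\<^sup>2 / 2"
    and c_pos: "0 < c"
begin

text \<open>The expectation at the tilt \<open>c + d\<close> is at least \<open>K\<close>, while
  each outer part of the three-part split is at most \<open>K / 4\<close> for large
  \<open>n\<close>. Hence at least \<open>K / 2\<close> comes from the middle part, where the
  integrand is at most \<open>exp (a n * (c + d) * (c + 2 * d))\<close>; dividing by this bounds the
  probability from below.\<close>

lemma quadratic_rate_lower:
  assumes r: "r < - (c\<^sup>2 / 2)"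
  shows "\<forall>\<^sub>F n in sequentially. exp (a n * r) < prob {\<omega> \<in> space M. Y n \<omega> > c}"
proof -
  \<comment> \<open>The rate left after dividing \<open>K\<close> by the bound on the middle part.
    It tends to \<open>- (c\<^sup>2 / 2)\<close> as \<open>d\<close> decreases to 0, so some
    \<open>d > 0\<close> keeps it above \<open>r\<close>.\<close>
  define q where "q d = - ((c + d)\<^sup>2 / 2) - (c + d) * d - d\<^sup>2 / 8" for d
  have "(q \<longlongrightarrow> - ((c + 0)\<^sup>2 / 2) - (c + 0) * 0 - 0\<^sup>2 / 8) (at_right 0)"
    unfolding q_def by (intro tendsto_intros) auto
  then have "\<forall>\<^sub>F d in at_right 0. r < q d"
    using r by (intro order_tendstoD) auto
  moreover have "\<forall>\<^sub>F d in at_right 0. (0::real) < d"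
    by (rule eventually_at_right_less)
  ultimately obtain d where d: "0 < d" "r < q d"
    using eventually_happens[OF eventually_conj] by (metis trivial_limit_at_right_real)
  \<comment> \<open>Without slack the rates of the outer parts lie \<open>d\<^sup>2 / 2\<close>
    below that of the tilted expectation. Spending \<open>d\<^sup>2 / 8\<close> on each side of the
    comparison still leaves a gap of \<open>d\<^sup>2 / 4\<close>.\<close>
  have eps: "0 < d\<^sup>2 / 8"
    using d by simp
  have int': "\<forall>\<^sub>F n in sequentially. integrable M (\<lambda>\<omega>. exp (a n * s * Y n \<omega>))" if "0 < s" for s
    using int by eventually_elim (use that in auto)
  note up = quadratic_rate_mgf_bounds(1)[OF a_top int' lim eps]
  note lo = quadratic_rate_mgf_bounds(2)[OF a_top int' lim eps]
  have E1: "\<forall>\<^sub>F n in sequentially. expectation (\<lambda>\<omega>. exp (a n * c * Y n \<omega>)) \<le> exp (a n * (c\<^sup>2 / 2 + d\<^sup>2 / 8))"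
    using c_pos by (intro up)
  have E2: "\<forall>\<^sub>F n in sequentially. expectation (\<lambda>\<omega>. exp (a n * (c + 2 * d) * Y n \<omega>))
      \<le> exp (a n * ((c + 2 * d)\<^sup>2 / 2 + d\<^sup>2 / 8))"
    using c_pos d by (intro up) auto
  have E3: "\<forall>\<^sub>F n in sequentially. exp (a n * ((c + d)\<^sup>2 / 2 - d\<^sup>2 / 8))
      \<le> expectation (\<lambda>\<omega>. exp (a n * (c + d) * Y n \<omega>))"
    using c_pos d by (intro lo) auto
  \<comment> \<open>The first threshold makes \<open>exp (- (a n * (d\<^sup>2 / 4)))\<close> at most
    \<open>1 / 4\<close>; the second lets the gap \<open>q d - r\<close> absorb the factor
    \<open>1 / 2\<close> that remains at the end.\<close>
  have a1: "\<forall>\<^sub>F n in sequentially. max 0 (ln 4 / (d\<^sup>2 / 4)) < a n"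
    and a2: "\<forall>\<^sub>F n in sequentially. ln 2 / (q d - r) < a n"
    using a_top by (simp_all only: filterlim_at_top_dense)
  from E1 E2 E3 a1 a2 int show ?thesis
  proof eventually_elim
    case (elim n)
    define P where "P = prob {\<omega> \<in> space M. Y n \<omega> > c}"
    define K where "K = exp (a n * ((c + d)\<^sup>2 / 2 - d\<^sup>2 / 8))"
    have "0 < a n" using elim(4) by (rule le_less_trans[OF max.cobounded1])
    have "ln 4 < a n * (d\<^sup>2 / 4)"
      using elim(4) d by (simp add: divide_simps mult_ac)
    then have "exp (- (a n * (d\<^sup>2 / 4))) \<le> exp (- ln 4)"
      by simp
    also have "\<dots> = 1 / 4"
      by (simp add: exp_minus)
    finally have small: "exp (- (a n * (d\<^sup>2 / 4))) \<le> 1 / 4" .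
    have "exp (a n * d * c) * expectation (\<lambda>\<omega>. exp (a n * c * Y n \<omega>))
        \<le> exp (a n * d * c) * exp (a n * (c\<^sup>2 / 2 + d\<^sup>2 / 8))"
      using elim by (intro mult_left_mono) auto
    also have "\<dots> = K * exp (- (a n * (d\<^sup>2 / 4)))"
      unfolding K_def exp_add[symmetric] by (simp add: field_simps power2_eq_square)
    also have "\<dots> \<le> K * (1 / 4)"
      using small by (intro mult_left_mono) (auto simp: K_def)
    finally have part1: "exp (a n * d * c) * expectation (\<lambda>\<omega>. exp (a n * c * Y n \<omega>)) \<le> K * (1 / 4)" .
    have "exp (- (a n * d * (c + 2 * d))) * expectation (\<lambda>\<omega>. exp (a n * (c + 2 * d) * Y n \<omega>))
        \<le> exp (- (a n * d * (c + 2 * d))) * exp (a n * ((c + 2 * d)\<^sup>2 / 2 + d\<^sup>2 / 8))"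
      using elim by (intro mult_left_mono) auto
    also have "\<dots> = K * exp (- (a n * (d\<^sup>2 / 4)))"
      unfolding K_def exp_add[symmetric] by (simp add: field_simps power2_eq_square)
    also have "\<dots> \<le> K * (1 / 4)"
      using small by (intro mult_left_mono) (auto simp: K_def)
    finally have part3: "exp (- (a n * d * (c + 2 * d))) * expectation (\<lambda>\<omega>. exp (a n * (c + 2 * d) * Y n \<omega>))
        \<le> K * (1 / 4)" .
    have "K \<le> expectation (\<lambda>\<omega>. exp (a n * (c + d) * Y n \<omega>))"
      using elim by (simp add: K_def)
    also have "\<dots> \<le> K * (1 / 4) + exp (a n * (c + d) * (c + 2 * d)) * P + K * (1 / 4)"
      using mgf_three_part_split[OF rv, of "a n" n c d] elim(6) c_pos d \<open>0 < a n\<close> part1 part3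
      unfolding P_def by (smt (verit))
    finally have "K / 2 \<le> exp (a n * (c + d) * (c + 2 * d)) * P"
      by simp
    then have "K / 2 / exp (a n * (c + d) * (c + 2 * d)) \<le> P"
      by (simp add: pos_divide_le_eq mult.commute)
    then have "exp (- (a n * (c + d) * (c + 2 * d))) * (K / 2) \<le> P"
      unfolding exp_minus divide_inverse by (simp only: mult_ac)
    moreover have "exp (- (a n * (c + d) * (c + 2 * d))) * K = exp (a n * q d)"
      unfolding K_def exp_add[symmetric] q_def by (simp add: field_simps power2_eq_square)
    ultimately have PQ: "exp (a n * q d) / 2 \<le> P"
      by simp
    have "ln 2 < a n * (q d - r)"
      using elim(5) d by (simp add: pos_divide_less_eq)
    then have "exp (ln 2) < exp (a n * (q d - r))"
      by (simp only: exp_less_cancel_iff)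
    then have "2 * exp (a n * r) < exp (a n * q d)"
      by (simp add: exp_diff right_diff_distrib pos_less_divide_eq)
    with PQ show ?case
      by (simp add: P_def)
  qed
qed

text \<open>Any rate below \<open>- (c\<^sup>2 / 2)\<close> in the lower bound gives this.
  Positivity is what allows passing between the tail probability and its logarithm.\<close>

lemma quadratic_rate_tail_pos:
  "\<forall>\<^sub>F n in sequentially. 0 < prob {\<omega> \<in> space M. Y n \<omega> > c}"
proof -
  have "\<forall>\<^sub>F n in sequentially. exp (a n * (- (c\<^sup>2 / 2) - 1)) < prob {\<omega> \<in> space M. Y n \<omega> > c}"
    by (rule quadratic_rate_lower) simp
  then show ?thesis
    by (rule eventually_mono) (rule less_trans[OF exp_gt_zero])
qed

text \<open>The lower half is \<open>quadratic_rate_lower\<close> after taking logarithms. The upper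
  half is Chernoff's inequality at the tilt \<open>s = c\<close>, which minimizes
  \<open>s\<^sup>2 / 2 - s * c\<close> with value \<open>- (c\<^sup>2 / 2)\<close>.\<close>

lemma quadratic_rate_tail:
  "(\<lambda>n. ln (prob {\<omega> \<in> space M. Y n \<omega> > c}) / a n) \<longlonglongrightarrow> - (c\<^sup>2 / 2)"
proof (rule order_tendstoI)
  have pos: "\<forall>\<^sub>F n in sequentially. 0 < a n"
    using a_top by (simp add: filterlim_at_top_dense)
  fix r assume "r < - (c\<^sup>2 / 2)"
  from quadratic_rate_lower[OF this] quadratic_rate_tail_pos pos
  show "\<forall>\<^sub>F n in sequentially. r < ln (prob {\<omega> \<in> space M. Y n \<omega> > c}) / a n"
  proof eventually_elim
    case (elim n)
    have "a n * r < ln (prob {\<omega> \<in> space M. Y n \<omega> > c})"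
      using ln_less_cancel_iff[of "exp (a n * r)"] elim(1,2) by simp
    then show ?case
      using elim by (simp add: pos_less_divide_eq mult_ac)
  qed
next
  have pos: "\<forall>\<^sub>F n in sequentially. 0 < a n"
    using a_top by (simp add: filterlim_at_top_dense)
  fix r assume r: "- (c\<^sup>2 / 2) < r"
  \<comment> \<open>Half of the distance from the limit to \<open>r\<close>, so that the Chernoff
    exponent stays strictly below \<open>r\<close>.\<close>
  define e where "e = (r + c\<^sup>2 / 2) / 2"
  have e: "0 < e" "- c\<^sup>2 / 2 + e < r"
    using r by (auto simp: e_def field_simps)
  have int': "\<forall>\<^sub>F n in sequentially. integrable M (\<lambda>\<omega>. exp (a n * c * Y n \<omega>))"
    using int by eventually_elim (use c_pos in auto)
  from quadratic_rate_mgf_bounds(1)[OF a_top int' lim[OF c_pos] e(1)] quadratic_rate_tail_pos pos int'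
  show "\<forall>\<^sub>F n in sequentially. ln (prob {\<omega> \<in> space M. Y n \<omega> > c}) / a n < r"
  proof eventually_elim
    case (elim n)
    have "prob {\<omega> \<in> space M. Y n \<omega> > c}
        \<le> exp (- (a n * c * c)) * expectation (\<lambda>\<omega>. exp (a n * c * Y n \<omega>))"
      using elim c_pos by (intro chernoff_upper_tail rv) auto
    also have "\<dots> \<le> exp (- (a n * c * c)) * exp (a n * (c\<^sup>2 / 2 + e))"
      using elim by (intro mult_left_mono) auto
    also have "\<dots> = exp (a n * (- c\<^sup>2 / 2 + e))"
      unfolding exp_add[symmetric] by (simp add: field_simps power2_eq_square)
    finally have "ln (prob {\<omega> \<in> space M. Y n \<omega> > c}) \<le> a n * (- c\<^sup>2 / 2 + e)"
      using ln_le_cancel_iff[of _ "exp (a n * (- c\<^sup>2 / 2 + e))"] elim(2) by simp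
    also have "\<dots> < a n * r"
      using elim e by (intro mult_strict_left_mono) auto
    finally show ?case
      using elim by (simp add: pos_divide_less_eq mult_ac)
  qed
qed

end

end

text \<open>Linear growth of \<open>B\<close> makes the tilt of order
  \<open>n powr (\<alpha> - 1 / 2)\<close>. This is where \<open>\<alpha> < 1/2\<close> enters: the
  tilt applied to each summand vanishes, and with it the error in the Taylor bounds.\<close>

lemma tilt_tendsto_0:
  fixes B :: "nat \<Rightarrow> real"
  assumes "0 < c\<^sub>1" and B: "\<And>n. c\<^sub>1 * real n \<le> B n" and "\<alpha> < 1/2" and "0 < s"
  shows "(\<lambda>n. s * real n powr \<alpha> / sqrt (B n)) \<longlonglongrightarrow> 0"
proof (rule tendsto_sandwich)
  have B_nonneg: "0 \<le> B n" for n
    using \<open>0 < c\<^sub>1\<close> by (intro order_trans[OF _ B]) simp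
  then show "\<forall>\<^sub>F n in sequentially. 0 \<le> s * real n powr \<alpha> / sqrt (B n)"
    using \<open>0 < s\<close> by (intro always_eventually allI divide_nonneg_nonneg mult_nonneg_nonneg) auto
  show "\<forall>\<^sub>F n in sequentially. s * real n powr \<alpha> / sqrt (B n)
      \<le> s / sqrt c\<^sub>1 * real n powr (\<alpha> - 1 / 2)"
    using eventually_gt_at_top[of 0]
  proof eventually_elim
    case (elim n)
    have "sqrt c\<^sub>1 * sqrt (real n) \<le> sqrt (B n)"
      using B[of n] by (simp flip: real_sqrt_mult)
    moreover have "0 < sqrt c\<^sub>1 * sqrt (real n)"
      using \<open>0 < c\<^sub>1\<close> elim by simp
    moreover from calculation have "0 < sqrt (B n)"
      by linarith
    ultimately have "s * real n powr \<alpha> / sqrt (B n) \<le> s * real n powr \<alpha> / (sqrt c\<^sub>1 * sqrt (real n))"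
      using \<open>0 < s\<close> by (intro divide_left_mono mult_nonneg_nonneg) (simp_all only: mult_pos_pos powr_ge_zero less_imp_le)
    also have "\<dots> = s / sqrt c\<^sub>1 * real n powr (\<alpha> - 1 / 2)"
      using elim by (simp add: powr_diff powr_half_sqrt)
    finally show ?case .
  qed
  have "(\<lambda>n. real n powr (\<alpha> - 1 / 2)) \<longlonglongrightarrow> 0"
    using assms by (intro tendsto_neg_powr filterlim_real_sequentially) auto
  then show "(\<lambda>n. s / sqrt c\<^sub>1 * real n powr (\<alpha> - 1 / 2)) \<longlonglongrightarrow> 0"
    by (rule tendsto_mult_right_zero)
qed simp

section \<open>Moderate deviations of the empirical mean\<close>

theorem corollary4p2:
  fixes M :: "'a measure" and X :: "nat \<Rightarrow> 'a \<Rightarrow> real" and c\<^sub>0 c\<^sub>1 c \<alpha> :: real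
  assumes "prob_space M"
    and "prob_space.indep_vars M (\<lambda>_. borel) X {1..}"
    and "\<And>k. k \<ge> 1 \<Longrightarrow> prob_space.expectation M (X k) = 0"
    and "c\<^sub>0 > 0"
    and "\<And>k. k \<ge> 1 \<Longrightarrow> AE \<omega> in M. \<bar>X k \<omega>\<bar> \<le> c\<^sub>0"
    and "c\<^sub>1 > 0"
    and "\<And>k. k \<ge> 1 \<Longrightarrow> prob_space.variance M (X k) \<ge> c\<^sub>1"
    and "c > 0"
    and "0 < \<alpha>" and "\<alpha> < 1/2"
  shows "(\<exists>\<epsilon> :: nat \<Rightarrow> real. \<epsilon> \<longlonglongrightarrow> 0 \<and>
           (\<forall>\<^sub>F n in sequentially.
              measure M {\<omega> \<in> space M. empirical_mean X n \<omega>
                           > c * real n powr (\<alpha> - 1) * sqrt (second_moment_sum M X n)}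
              = exp (- (1/2) * c\<^sup>2 * real n powr (2 * \<alpha>) * (1 + \<epsilon> n))))
       \<and> (\<exists>\<epsilon> :: nat \<Rightarrow> real. \<epsilon> \<longlonglongrightarrow> 0 \<and>
           (\<forall>\<^sub>F n in sequentially.
              measure M {\<omega> \<in> space M. empirical_mean X n \<omega> > c * c\<^sub>0 * real n powr (\<alpha> - 1/2)}
                \<le> exp (- (1/2) * c\<^sup>2 * real n powr (2 * \<alpha>) * (1 + \<epsilon> n))
            \<and> exp (- (1/2) * c\<^sup>2 * real n powr (2 * \<alpha>) * (1 + \<epsilon> n))
                \<le> measure M {\<omega> \<in> space M. empirical_mean X n \<omega> > c * sqrt c\<^sub>1 * real n powr (\<alpha> - 1/2)}))"
proof -
  interpret prob_space M by fact
  note ind = assms(2) and mean = assms(3) and bd = assms(5)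
  define B where "B = second_moment_sum M X"
  define S where "S n \<omega> = (\<Sum>k=1..n. X k \<omega>)" for n \<omega>
  define a where "a n = real n powr (2 * \<alpha>)" for n
  define Y where "Y n \<omega> = S n \<omega> / (real n powr \<alpha> * sqrt (B n))" for n \<omega>
  have rv_X: "random_variable borel (X k)" if "1 \<le> k" for k
    using ind that by (auto simp: indep_vars_def)
  have rv: "random_variable borel (Y n)" for n
    unfolding Y_def S_def by (intro borel_measurable_divide borel_measurable_sum rv_X) auto
  \<comment> \<open>Centering identifies the variance with the second moment; summing the two bounds
    gives linear growth of \<open>B\<close> from both sides.\<close>
  have second_moment: "c\<^sub>1 \<le> expectation (\<lambda>\<omega>. (X k \<omega>)\<^sup>2)" "expectation (\<lambda>\<omega>. (X k \<omega>)\<^sup>2) \<le> c\<^sub>0\<^sup>2"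
    if "1 \<le> k" for k
    using assms(4,7) mean bounded_centered_mgf_bounds(3)[OF rv_X bd mean, of k 0] that by auto
  have B_lower: "c\<^sub>1 * real n \<le> B n" for n
    using sum_mono[of "{1..n}" "\<lambda>_. c\<^sub>1" "\<lambda>k. expectation (\<lambda>\<omega>. (X k \<omega>)\<^sup>2)"] second_moment
    by (simp add: B_def second_moment_sum_def mult.commute)
  have B_upper: "B n \<le> c\<^sub>0\<^sup>2 * real n" for n
    using sum_mono[of "{1..n}" "\<lambda>k. expectation (\<lambda>\<omega>. (X k \<omega>)\<^sup>2)" "\<lambda>_. c\<^sub>0\<^sup>2"] second_moment
    by (simp add: B_def second_moment_sum_def mult.commute)
  have B_pos: "0 < B n" if "0 < n" for n
    using B_lower[of n] mult_pos_pos[of c\<^sub>1 "real n"] \<open>0 < c\<^sub>1\<close> that by linarith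
  have a_pos: "0 < a n" if "0 < n" for n
    using that by (simp add: a_def)
  have a_top: "filterlim a at_top sequentially"
  proof -
    have "filterlim (\<lambda>n. exp (2 * \<alpha> * ln (real n))) at_top sequentially"
      using \<open>0 < \<alpha>\<close>
      by (intro filterlim_compose[OF exp_at_top] filterlim_tendsto_pos_mult_at_top[OF tendsto_const]
          filterlim_compose[OF ln_at_top] filterlim_real_sequentially) auto
    moreover have eq: "\<forall>\<^sub>F n in sequentially. exp (2 * \<alpha> * ln (real n)) = a n"
      using eventually_gt_at_top[of 0] by eventually_elim (simp add: a_def powr_def)
    ultimately show ?thesis
      using filterlim_cong[OF refl refl eq] by metis
  qed

  \<comment> \<open>The tilt of the unscaled sum that corresponds to \<open>s\<close>: it satisfies
    \<open>a n * s * Y n = l s n * S n\<close>, and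
    \<open>(l s n)\<^sup>2 * B n = s\<^sup>2 * a n\<close> turns the variance term into the speed
    \<open>a n\<close>.\<close>
  define l where "l s n = s * real n powr \<alpha> / sqrt (B n)" for s n
  have l_nonneg: "0 \<le> l s n" if "0 < s" "0 < n" for s n
    using that B_pos[of n] by (auto simp: l_def intro!: divide_nonneg_nonneg)
  have l_lim: "l s \<longlonglongrightarrow> 0" if "0 < s" for s
    unfolding l_def using tilt_tendsto_0[OF \<open>0 < c\<^sub>1\<close> B_lower \<open>\<alpha> < 1/2\<close> that] .
  have powr_sq: "real n powr (2 * \<alpha>) = (real n powr \<alpha>)\<^sup>2" for n
    by (simp add: power2_eq_square flip: powr_add)
  have l_Y: "a n * s * Y n \<omega> = l s n * S n \<omega>" for n s \<omega>
    by (cases "n = 0") (simp_all add: a_def Y_def l_def powr_sq power2_eq_square)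
  have l_B: "(l s n)\<^sup>2 * B n = s\<^sup>2 * a n" if "0 < n" for s n
    using B_pos[OF that] by (simp add: l_def a_def powr_sq power_mult_distrib power_divide)
  have ind_n: "indep_vars (\<lambda>_. borel) X {1..n}" for n
    by (rule indep_vars_subset[OF ind]) auto
  note mgf = bounded_centered_sum_mgf_bounds[OF _ ind_n, of _ "c\<^sub>0",
      folded S_def second_moment_sum_def B_def]
  have int: "integrable M (\<lambda>\<omega>. exp (a n * s * Y n \<omega>))" if "0 < s" "0 < n" for s n
    unfolding l_Y using mgf(1)[of n "l s n"] bd mean l_nonneg[OF that] \<open>0 < c\<^sub>0\<close> by auto
  have mgf_lim: "(\<lambda>n. ln (expectation (\<lambda>\<omega>. exp (a n * s * Y n \<omega>))) / a n) \<longlonglongrightarrow> s\<^sup>2 / 2"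
    if s: "0 < s" for s
  \<comment> \<open>After division by \<open>a n\<close> both bounds are
    \<open>s\<^sup>2 / 2\<close> times a correction factor that tends to 1, since
    \<open>l s n\<close> tends to 0 while the bound \<open>c\<^sub>0\<close> is fixed.\<close>
  proof (rule tendsto_sandwich)
    show "\<forall>\<^sub>F n in sequentially. s\<^sup>2 / 2 * (exp (- (l s n * c\<^sub>0)) / (1 + (l s n)\<^sup>2 * c\<^sub>0\<^sup>2 / 2))
        \<le> ln (expectation (\<lambda>\<omega>. exp (a n * s * Y n \<omega>))) / a n"
      using eventually_gt_at_top[of 0]
    proof eventually_elim
      case (elim n)
      have "exp (s\<^sup>2 * a n / 2 * (exp (- (l s n * c\<^sub>0)) / (1 + (l s n)\<^sup>2 * c\<^sub>0\<^sup>2 / 2)))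
          \<le> expectation (\<lambda>\<omega>. exp (a n * s * Y n \<omega>))"
        using mgf(3)[of n "l s n"] bd mean l_nonneg[OF s elim] \<open>0 < c\<^sub>0\<close>
        unfolding l_B[OF elim] l_Y by auto
      then have "s\<^sup>2 * a n / 2 * (exp (- (l s n * c\<^sub>0)) / (1 + (l s n)\<^sup>2 * c\<^sub>0\<^sup>2 / 2))
          \<le> ln (expectation (\<lambda>\<omega>. exp (a n * s * Y n \<omega>)))"
        using exp_expectation_pos[OF int[OF s elim]] by (simp add: ln_ge_iff)
      then show ?case
        using a_pos[OF elim] by (simp add: pos_le_divide_eq mult_ac)
    qed
    show "\<forall>\<^sub>F n in sequentially. ln (expectation (\<lambda>\<omega>. exp (a n * s * Y n \<omega>))) / a n
        \<le> s\<^sup>2 / 2 * exp (l s n * c\<^sub>0)"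
      using eventually_gt_at_top[of 0]
    proof eventually_elim
      case (elim n)
      have "expectation (\<lambda>\<omega>. exp (a n * s * Y n \<omega>)) \<le> exp (s\<^sup>2 * a n / 2 * exp (l s n * c\<^sub>0))"
        using mgf(2)[of n "l s n"] bd mean l_nonneg[OF s elim] \<open>0 < c\<^sub>0\<close>
        unfolding l_B[OF elim] l_Y by auto
      then have "ln (expectation (\<lambda>\<omega>. exp (a n * s * Y n \<omega>))) \<le> s\<^sup>2 * a n / 2 * exp (l s n * c\<^sub>0)"
        using exp_expectation_pos[OF int[OF s elim]] by (metis exp_le_cancel_iff exp_ln)
      then show ?case
        using a_pos[OF elim] by (simp add: pos_divide_le_eq mult_ac)
    qed
    have "(\<lambda>n. s\<^sup>2 / 2 * (exp (- (l s n * c\<^sub>0)) / (1 + (l s n)\<^sup>2 * c\<^sub>0\<^sup>2 / 2)))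
        \<longlonglongrightarrow> s\<^sup>2 / 2 * (exp (- (0 * c\<^sub>0)) / (1 + 0\<^sup>2 * c\<^sub>0\<^sup>2 / 2))"
      by (intro tendsto_intros l_lim s) auto
    then show "(\<lambda>n. s\<^sup>2 / 2 * (exp (- (l s n * c\<^sub>0)) / (1 + (l s n)\<^sup>2 * c\<^sub>0\<^sup>2 / 2))) \<longlonglongrightarrow> s\<^sup>2 / 2"
      by simp
    have "(\<lambda>n. s\<^sup>2 / 2 * exp (l s n * c\<^sub>0)) \<longlonglongrightarrow> s\<^sup>2 / 2 * exp (0 * c\<^sub>0)"
      by (intro tendsto_intros l_lim s)
    then show "(\<lambda>n. s\<^sup>2 / 2 * exp (l s n * c\<^sub>0)) \<longlonglongrightarrow> s\<^sup>2 / 2"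
      by simp
  qed
  have int_ev: "\<forall>\<^sub>F n in sequentially. \<forall>s>0. integrable M (\<lambda>\<omega>. exp (a n * s * Y n \<omega>))"
    using eventually_gt_at_top[of 0] by eventually_elim (use int in auto)
  define P where "P n = prob {\<omega> \<in> space M. Y n \<omega> > c}" for n
  have tail: "(\<lambda>n. ln (P n) / a n) \<longlonglongrightarrow> - (c\<^sup>2 / 2)"
    unfolding P_def using mgf_lim
    by (rule quadratic_rate_tail[OF rv a_top int_ev _ \<open>0 < c\<close>])
  have tail_pos: "\<forall>\<^sub>F n in sequentially. 0 < P n"
    unfolding P_def using mgf_lim
    by (rule quadratic_rate_tail_pos[OF rv a_top int_ev _ \<open>0 < c\<close>])
  \<comment> \<open>Obtained by solving
    \<open>P n = exp (- (1/2) * c\<^sup>2 * a n * (1 + \<epsilon> n))\<close> for \<epsilon>. The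
    equation is exact once \<open>n > 0\<close> and \<open>P n > 0\<close>, and the limit of
    \<open>ln (P n) / a n\<close> yields
    \<open>\<epsilon> \<longlonglongrightarrow> 0\<close>.\<close>
  define \<epsilon> where "\<epsilon> n = (- 2 / c\<^sup>2) * (ln (P n) / a n) - 1" for n
  have "\<epsilon> \<longlonglongrightarrow> (- 2 / c\<^sup>2) * (- (c\<^sup>2 / 2)) - 1"
    unfolding \<epsilon>_def by (intro tendsto_intros tail)
  then have eps_lim: "\<epsilon> \<longlonglongrightarrow> 0"
    using \<open>0 < c\<close> by simp
  have event: "empirical_mean X n \<omega> > c * real n powr (\<alpha> - 1) * sqrt (B n) \<longleftrightarrow> Y n \<omega> > c"
    if "0 < n" for n \<omega>
    using B_pos[OF that] that
    by (simp add: empirical_mean_def Y_def S_def powr_diff field_simps)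
  have eps_eq: "\<forall>\<^sub>F n in sequentially. measure M {\<omega> \<in> space M. empirical_mean X n \<omega>
                           > c * real n powr (\<alpha> - 1) * sqrt (B n)}
              = exp (- (1/2) * c\<^sup>2 * real n powr (2 * \<alpha>) * (1 + \<epsilon> n))"
    using eventually_gt_at_top[of 0] tail_pos
  proof eventually_elim
    case (elim n)
    have "- (1/2) * c\<^sup>2 * real n powr (2 * \<alpha>) * (1 + \<epsilon> n) = ln (P n)"
      using \<open>0 < c\<close> a_pos[OF elim(1)] by (simp add: \<epsilon>_def a_def)
    then show ?case
      using elim(2) by (simp add: event[OF elim(1)] P_def)
  qed
  have measurable_mean: "{\<omega> \<in> space M. empirical_mean X n \<omega> > t} \<in> events" for n t
  proof -
    have "random_variable borel (\<lambda>\<omega>. empirical_mean X n \<omega>)"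
      unfolding empirical_mean_def
      by (intro borel_measurable_times borel_measurable_const borel_measurable_sum rv_X) auto
    then show ?thesis
      by measurable
  qed
  have mono: "measure M {\<omega> \<in> space M. empirical_mean X n \<omega> > t}
      \<le> measure M {\<omega> \<in> space M. empirical_mean X n \<omega> > u}" if "u \<le> t" for n t u
    using that by (intro finite_measure_mono measurable_mean) auto
  have split_powr: "real n powr (\<alpha> - 1 / 2) = real n powr (\<alpha> - 1) * sqrt (real n)" for n
    by (cases "n = 0") (simp_all flip: powr_half_sqrt powr_add)
  \<comment> \<open>Square roots of the linear bounds on \<open>B n\<close>, with
    \<open>sqrt (real n)\<close> merged into the power of \<open>n\<close> by
    \<open>split_powr\<close>.\<close>
  have thresholds:
    "c * real n powr (\<alpha> - 1) * sqrt (B n) \<le> c * c\<^sub>0 * real n powr (\<alpha> - 1/2)"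
    "c * sqrt c\<^sub>1 * real n powr (\<alpha> - 1/2) \<le> c * real n powr (\<alpha> - 1) * sqrt (B n)" for n
  proof -
    have "sqrt (B n) \<le> c\<^sub>0 * sqrt (real n)"
      using real_sqrt_le_mono[OF B_upper[of n]] \<open>0 < c\<^sub>0\<close> by (simp add: real_sqrt_mult)
    moreover have "sqrt c\<^sub>1 * sqrt (real n) \<le> sqrt (B n)"
      using real_sqrt_le_mono[OF B_lower[of n]] by (simp add: real_sqrt_mult)
    ultimately have "c * real n powr (\<alpha> - 1) * sqrt (B n) \<le> c * real n powr (\<alpha> - 1) * (c\<^sub>0 * sqrt (real n))"
      "c * real n powr (\<alpha> - 1) * (sqrt c\<^sub>1 * sqrt (real n)) \<le> c * real n powr (\<alpha> - 1) * sqrt (B n)"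
      using \<open>0 < c\<close> by (auto intro!: mult_left_mono)
    then show "c * real n powr (\<alpha> - 1) * sqrt (B n) \<le> c * c\<^sub>0 * real n powr (\<alpha> - 1/2)"
      "c * sqrt c\<^sub>1 * real n powr (\<alpha> - 1/2) \<le> c * real n powr (\<alpha> - 1) * sqrt (B n)"
      unfolding split_powr by (simp_all only: mult_ac)
  qed
  show ?thesis
  proof (intro conjI exI[of _ \<epsilon>] eps_lim)
    show "\<forall>\<^sub>F n in sequentially.
      measure M {\<omega> \<in> space M. empirical_mean X n \<omega>
          > c * real n powr (\<alpha> - 1) * sqrt (second_moment_sum M X n)}
        = exp (- (1/2) * c\<^sup>2 * real n powr (2 * \<alpha>) * (1 + \<epsilon> n))"
      using eps_eq unfolding B_def .
    show "\<forall>\<^sub>F n in sequentially.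
      measure M {\<omega> \<in> space M. empirical_mean X n \<omega> > c * c\<^sub>0 * real n powr (\<alpha> - 1/2)}
        \<le> exp (- (1/2) * c\<^sup>2 * real n powr (2 * \<alpha>) * (1 + \<epsilon> n))
      \<and> exp (- (1/2) * c\<^sup>2 * real n powr (2 * \<alpha>) * (1 + \<epsilon> n))
        \<le> measure M {\<omega> \<in> space M. empirical_mean X n \<omega> > c * sqrt c\<^sub>1 * real n powr (\<alpha> - 1/2)}"
      using eps_eq
    proof eventually_elim
      case (elim n)
      show ?case
        \<comment> \<open>The exponential is turned back into the exact probability of the first
          claim, so the same \<epsilon> serves here and only a comparison of nested events
          remains.\<close>
        unfolding elim[symmetric] by (intro conjI mono thresholds)
    qed
  qed
qed

end
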